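(* Let $L(\lambda)=\lambda M+K\in\mathbb{C}^{2n\times2n}[\lambda]$ be a regular $*$-skew-Hamiltonian/Hamiltonian ($*$-SHH) pencil. Let $(X_c,\Lambda_c)$ and $(X_f,\Lambda_f)$ be complementary deflating pairs of $L(\lambda)$, where $$\Lambda_c=\mathrm{diag}(\lambda_1^c,-\overline{\lambda_1^c},\dots,\lambda_m^c,-\overline{\lambda_m^c},\lambda_{m+1}^c,\dots,\lambda_p^c),$$ $\mathrm{re}(\lambda_j^c)\ne0$ for $j=1,\dots,m$, and $\lambda_k^c$ is purely imaginary for $k=m+1,\dots,p$. Let $$\Lambda_a=\mathrm{diag}(\lambda_1^a,-\overline{\lambda_1^a},\dots,\lambda_m^a,-\overline{\lambda_m^a},\lambda_{m+1}^a,\dots,\lambda_p^a),$$ where $\mathrm{re}(\lambda_j^a)\ne0$ for $j=1,\dots,m$ and $\lambda_k^a$ is purely imaginary for $k=m+1,\dots,p$. Suppose that (a) $\sigma(\Lambda_c)\cap\sigma(-\Lambda_f^* )=\emptyset$, (b) $G:=X_c^*JMX_c$ is nonsingular, and that the $\lambda_i^c$ are simple eigenvalues of $L(\lambda)$. Put $U:=JMX_cG^{-1}$ and, for a matrix $\hat M\in\mathbb{C}^{(m+p)\times(m+p)}$, $$\Delta M=J^*U\hat MU^*,\qquad \Delta K=J^*U\left(G\Lambda_c-(G+\hat M)\Lambda_a\right)U^*.$$ Then for arbitrary $\hat M$ the pairs $(X_c,\Lambda_a)$ and $(X_f,\Lambda_f)$ are complementary deflating pairs of $L_\Delta(\lambda)=\lambda(M+\Delta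 M)+(K+\Delta K)$. Further, if $\hat M=\mathrm{diag}(\hat M_1,\dots,\hat M_m,\hat m_{m+1},\dots,\hat m_p)$ where $\hat M_j=\begin{bmatrix}0&\alpha_j\\-\overline{\alpha_j}&0\end{bmatrix}$ with $\alpha_j\in\mathbb{C}$, $\mathrm{re}(\alpha_j)\neq0$ $(1\le j\le m)$, and $\hat m_k$ are purely imaginary numbers $(m+1\le k\le p)$, then $L_\Delta(\lambda)$ is a $*$-SHH pencil.
   Context: $J=\begin{bmatrix}0&I_n\\-I_n&0\end{bmatrix}$. A pencil $\lambda M+K\in\mathbb{C}^{2n\times2n}[\lambda]$ is $*$-SHH if $(JM)^*=-JM$ and $(JK)^*=JK$, where $*$ denotes conjugate transpose. A pencil $\lambda M+K$ is regular if $\det(\lambda M+K)$ is not the zero polynomial. A deflating pair of a pencil $\lambda M+K\in\mathbb{C}^{N\times N}[\lambda]$ is a matrix pair $(X,\Lambda)\in\mathbb{C}^{N\times q}\times\mathbb{C}^{q\times q}$ with $\operatorname{rank}X=q\le N$ and $MX\Lambda+KX=0$. Two deflating pairs $(X_1,\Lambda_1)$, $(X_2,\Lambda_2)$ are complementary if $[X_1\ X_2]$ is a nonsingular square matrix. $\sigma(\Lambda)$ is the spectrum of $\Lambda$. *)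

theory Defs
  imports
    "Jordan_Normal_Form.DL_Rank"
    "Jordan_Normal_Form.Schur_Decomposition"
    "Jordan_Normal_Form.Spectral_Radius"
begin

definition Jmat :: "nat \<Rightarrow> complex mat" where
  "Jmat n = four_block_mat (0\<^sub>m n n) (1\<^sub>m n) (- 1\<^sub>m n) (0\<^sub>m n n)"

(* A pencil is given by its coefficient matrices M and K; the polynomial matrix
   lambda M + K is needed for its determinant, a polynomial in lambda. *)
definition pencil :: "complex mat \<Rightarrow> complex mat \<Rightarrow> complex poly mat" where
  "pencil M K = [:0, 1:] \<cdot>\<^sub>m map_mat (\<lambda>x. [:x:]) M + map_mat (\<lambda>x. [:x:]) K"

definition regular_pencil :: "complex mat \<Rightarrow> complex mat \<Rightarrow> bool" where
  "regular_pencil M K \<longleftrightarrow> det (pencil M K) \<noteq> 0"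

(* "Simple" means algebraic multiplicity one. *)
definition simple_pencil_eigenvalue :: "complex mat \<Rightarrow> complex mat \<Rightarrow> complex \<Rightarrow> bool" where
  "simple_pencil_eigenvalue M K z \<longleftrightarrow> Polynomial.order z (det (pencil M K)) = 1"

definition star_SHH :: "nat \<Rightarrow> complex mat \<Rightarrow> complex mat \<Rightarrow> bool" where
  "star_SHH n M K \<longleftrightarrow>
     M \<in> carrier_mat (2 * n) (2 * n) \<and> K \<in> carrier_mat (2 * n) (2 * n) \<and>
     mat_adjoint (Jmat n * M) = - (Jmat n * M) \<and>
     mat_adjoint (Jmat n * K) = Jmat n * K"

definition deflating_pair ::
  "nat \<Rightarrow> nat \<Rightarrow> complex mat \<Rightarrow> complex mat \<Rightarrow> complex mat \<Rightarrow> complex mat \<Rightarrow> bool" where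
  "deflating_pair N q M K X \<Lambda> \<longleftrightarrow>
     M \<in> carrier_mat N N \<and> K \<in> carrier_mat N N \<and>
     X \<in> carrier_mat N q \<and> \<Lambda> \<in> carrier_mat q q \<and>
     vec_space.rank N X = q \<and> q \<le> N \<and>
     M * X * \<Lambda> + K * X = 0\<^sub>m N q"

(* mat_of_cols N (cols X1 @ cols X2) is the matrix [X1 X2];
   invertible_mat includes squareness, i.e. q1 + q2 = N. *)
definition complementary_deflating_pairs ::
  "nat \<Rightarrow> nat \<Rightarrow> nat \<Rightarrow> complex mat \<Rightarrow> complex mat \<Rightarrow>
   complex mat \<Rightarrow> complex mat \<Rightarrow> complex mat \<Rightarrow> complex mat \<Rightarrow> bool" where
  "complementary_deflating_pairs N q1 q2 M K X1 \<Lambda>1 X2 \<Lambda>2 \<longleftrightarrow>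
     deflating_pair N q1 M K X1 \<Lambda>1 \<and> deflating_pair N q2 M K X2 \<Lambda>2 \<and>
     invertible_mat (mat_of_cols N (cols X1 @ cols X2))"

(* The entries l(1), -cnj l(1), ..., l(m), -cnj l(m), l(m+1), ..., l(p). *)
definition paired_list :: "nat \<Rightarrow> nat \<Rightarrow> (nat \<Rightarrow> complex) \<Rightarrow> complex list" where
  "paired_list m p l =
     concat (map (\<lambda>j. [l j, - cnj (l j)]) [1..<m + 1]) @ map l [m + 1..<p + 1]"

definition paired_diag :: "nat \<Rightarrow> nat \<Rightarrow> (nat \<Rightarrow> complex) \<Rightarrow> complex mat" where
  "paired_diag m p l =
     mat_diag (length (paired_list m p l)) (\<lambda>i. paired_list m p l ! i)"

definition paired_block_diag ::
  "nat \<Rightarrow> nat \<Rightarrow> (nat \<Rightarrow> complex) \<Rightarrow> (nat \<Rightarrow> complex) \<Rightarrow> complex mat" where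
  "paired_block_diag m p \<alpha> \<mu> = diag_block_mat
     (map (\<lambda>j. mat_of_rows_list 2 [[0, \<alpha> j], [- cnj (\<alpha> j), 0]]) [1..<m + 1] @
      map (\<lambda>k. mat_of_rows_list 1 [[\<mu> k]]) [m + 1..<p + 1])"

end

theory Submission
  imports Defs
begin

text \<open>
  Multiplying the pencil by $J$ turns its coefficients into a skew-Hermitian $S = JM$ and a
  Hermitian $H = JK$. For two deflating pairs, the relations $S X_i \Lambda_i = - H X_i$ and
  their adjoints give $(X_1^* S X_2) \Lambda_2 = - \Lambda_1^* (X_1^* S X_2)$
  (\<open>skew_form_intertwines\<close>). This identity is used twice.

  For the pairs $c$ and $f$ it is a homogeneous Sylvester equation, and the spectral condition
  leaves only $X_c^* S X_f = 0$ (\<open>sylvester_diag_unique\<close>). Since $U = S X_c G^{-1}$, it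
  follows that $U^* X_c = I$ and $U^* X_f = 0$. The updates are of the form $J^* U E U^*$, so
  they do not act on $X_f$, while on $X_c$ they act through the small matrix $E$; the choice of
  $E$ in $\Delta K$, together with $J^* U G = M X_c$, is exactly what replaces $\Lambda_c$ by
  $\Lambda_a$ (\<open>deflating_pair_replace\<close>, \<open>deflating_pair_keep\<close>).

  For the pair $c$ with itself the identity reads $G \Lambda_c = - \Lambda_c^* G$. Entrywise,
  $G_{ij} \neq 0$ forces the $j$-th diagonal entry of $\Lambda_c$ to be minus the conjugate of
  the $i$-th. Simplicity makes the diagonal entries of $\Lambda_c$ pairwise distinct
  (\<open>paired_list_distinct\<close>): a repeated entry $z$ gives two independent columns of $X_c$
  on which the pencil acts as $(\lambda - z) M$, hence a double root of its determinant. So $G$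
  is nonzero only at positions that couple an index with its partner in the pairing
  $\lambda, - \overline{\lambda}$, and the structured $\hat M$ has the same sparsity pattern.
  A skew-Hermitian matrix with that pattern has a Hermitian product with every diagonal
  matrix paired in this way (\<open>pair_supported_mult_Hermitian\<close>), in particular with
  $\Lambda_a$. Thus $J \Delta M = U \hat M U^*$ is skew-Hermitian and
  $J \Delta K = U (G \Lambda_c - (G + \hat M) \Lambda_a) U^*$ is Hermitian.
\<close>

section \<open>Conjugate transposes\<close>

lemma dim_mat_adjoint [simp]:
  "dim_row (mat_adjoint A) = dim_col A" "dim_col (mat_adjoint A) = dim_row A"
  by (simp_all add: mat_adjoint_def)

lemma mat_adjoint_carrier [simp]:
  "A \<in> carrier_mat a b \<Longrightarrow> mat_adjoint A \<in> carrier_mat b a"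
  by (rule carrier_matI) (simp_all add: carrier_matD)

lemma index_mat_adjoint [simp]:
  fixes A :: "complex mat"
  assumes "i < dim_col A" "j < dim_row A"
  shows "mat_adjoint A $$ (i, j) = cnj (A $$ (j, i))"
  using assms by (simp add: mat_adjoint_def mat_of_rows_def)

lemma mat_adjoint_adjoint [simp]: "mat_adjoint (mat_adjoint A) = (A :: complex mat)"
  by (rule eq_matI) auto

lemma mat_adjoint_mult:
  fixes A B :: "complex mat"
  assumes "dim_col A = dim_row B"
  shows "mat_adjoint (A * B) = mat_adjoint B * mat_adjoint A"
  using assms by (intro eq_matI) (auto simp: scalar_prod_def mult.commute)

lemma mat_adjoint_add:
  fixes A B :: "complex mat"
  assumes "dim_row A = dim_row B" "dim_col A = dim_col B"
  shows "mat_adjoint (A + B) = mat_adjoint A + mat_adjoint B"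
  using assms by (intro eq_matI) auto

lemma mat_adjoint_minus:
  fixes A B :: "complex mat"
  assumes "dim_row A = dim_row B" "dim_col A = dim_col B"
  shows "mat_adjoint (A - B) = mat_adjoint A - mat_adjoint B"
  using assms by (intro eq_matI) auto

lemma mat_adjoint_uminus: "mat_adjoint (- A) = - mat_adjoint (A :: complex mat)"
  by (intro eq_matI) auto

lemma mat_adjoint_one [simp]: "mat_adjoint (1\<^sub>m n) = (1\<^sub>m n :: complex mat)"
  by (intro eq_matI) auto

text \<open>Premises on dimensions rather than carriers leave no free size parameters, so the rule
  can be used by the simplifier.\<close>

lemma mult_mat_assoc:
  fixes A B C :: "complex mat"
  assumes "dim_col A = dim_row B" "dim_col B = dim_row C"
  shows "A * B * C = A * (B * C)"
  using assms by (intro assoc_mult_mat) auto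

lemma adjoint_congruence:
  fixes A U :: "complex mat"
  assumes "dim_row A = dim_col U" "dim_col A = dim_col U"
  shows "mat_adjoint (U * A * mat_adjoint U) = U * mat_adjoint A * mat_adjoint U"
  using assms by (simp add: mat_adjoint_mult mult_mat_assoc)

lemma Jmat_carrier [simp]: "Jmat n \<in> carrier_mat (2 * n) (2 * n)"
  by (auto simp: Jmat_def)

lemma Jmat_dim [simp]: "dim_row (Jmat n) = 2 * n" "dim_col (Jmat n) = 2 * n"
  using carrier_matD[OF Jmat_carrier] by auto

lemma mat_adjoint_Jmat: "mat_adjoint (Jmat n) = - Jmat n"
  by (rule eq_matI) (auto simp: Jmat_def)

lemma Jmat_square: "Jmat n * Jmat n = - 1\<^sub>m (2 * n)"
proof -
  have "Jmat n * Jmat n = four_block_mat (- 1\<^sub>m n) (0\<^sub>m n n) (0\<^sub>m n n) (- 1\<^sub>m n)"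
    unfolding Jmat_def by (subst mult_four_block_mat[of _ n n _ n _ n _ _ n _ n]) auto
  also have "\<dots> = - 1\<^sub>m (2 * n)"
    by (rule eq_matI) auto
  finally show ?thesis .
qed

lemma Jmat_unitary:
  "mat_adjoint (Jmat n) * Jmat n = 1\<^sub>m (2 * n)" "Jmat n * mat_adjoint (Jmat n) = 1\<^sub>m (2 * n)"
  by (simp_all add: mat_adjoint_Jmat Jmat_square)

section \<open>Orthogonality of deflating subspaces\<close>

text \<open>Both sides equal $- X_1^* H X_2$: on the left by the second deflating relation, on the
  right by the adjoint of the first, where the signs of $S^* = -S$ and $H^* = H$ enter.\<close>

lemma skew_form_intertwines:
  fixes S H X1 X2 \<Lambda>1 \<Lambda>2 :: "complex mat"
  assumes S: "S \<in> carrier_mat N N" "mat_adjoint S = - S"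
    and H: "H \<in> carrier_mat N N" "mat_adjoint H = H"
    and X1: "X1 \<in> carrier_mat N r" and \<Lambda>1: "\<Lambda>1 \<in> carrier_mat r r"
    and X2: "X2 \<in> carrier_mat N s" and \<Lambda>2: "\<Lambda>2 \<in> carrier_mat s s"
    and eq1: "S * X1 * \<Lambda>1 + H * X1 = 0\<^sub>m N r"
    and eq2: "S * X2 * \<Lambda>2 + H * X2 = 0\<^sub>m N s"
  shows "mat_adjoint X1 * S * X2 * \<Lambda>2 = - (mat_adjoint \<Lambda>1 * (mat_adjoint X1 * S * X2))"
proof -
  have neg: "A = - B"
    if "A + B = 0\<^sub>m a b" "A \<in> carrier_mat a b" "B \<in> carrier_mat a b"
    for A B :: "complex mat" and a b
  proof (rule eq_matI)
    fix i j assume "i < dim_row (- B)" "j < dim_col (- B)"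
    then have ij: "i < a" "j < b"
      using that by auto
    then have "A $$ (i, j) + B $$ (i, j) = (A + B) $$ (i, j)"
      using that(2,3) by simp
    also have "\<dots> = 0"
      unfolding that(1) using ij by simp
    finally show "A $$ (i, j) = (- B) $$ (i, j)"
      using that(2,3) ij by (simp add: eq_neg_iff_add_eq_0)
  qed (use that in auto)
  have e1: "S * X1 * \<Lambda>1 = - (H * X1)" and e2: "S * X2 * \<Lambda>2 = - (H * X2)"
    using assms by (auto intro!: neg)
  have "mat_adjoint (S * X1 * \<Lambda>1) = - (mat_adjoint \<Lambda>1 * (mat_adjoint X1 * S))"
    using assms by (simp add: mat_adjoint_mult mult_mat_assoc)
  moreover have "mat_adjoint (S * X1 * \<Lambda>1) = - (mat_adjoint X1 * H)"
    unfolding e1 using assms by (simp add: mat_adjoint_mult mat_adjoint_uminus)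
  ultimately have a1: "mat_adjoint \<Lambda>1 * (mat_adjoint X1 * S) = mat_adjoint X1 * H"
    by (metis uminus_uminus_mat)
  have "mat_adjoint X1 * S * X2 * \<Lambda>2 = mat_adjoint X1 * (S * X2 * \<Lambda>2)"
    using assms by (simp add: mult_mat_assoc)
  also have "\<dots> = - (mat_adjoint X1 * H * X2)"
    unfolding e2 using assms by (simp add: mult_mat_assoc)
  also have "\<dots> = - (mat_adjoint \<Lambda>1 * (mat_adjoint X1 * S * X2))"
    unfolding a1[symmetric] using assms by (simp add: mult_mat_assoc)
  finally show ?thesis .
qed

lemma eigenvalue_mat_diag:
  assumes "i < r"
  shows "d i \<in> spectrum (mat_diag r d :: complex mat)"
proof -
  have "mat_diag r d *\<^sub>v unit_vec r i = d i \<cdot>\<^sub>v unit_vec r i"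
    using assms by (intro eq_vecI) (auto simp: mat_diag_def)
  then show ?thesis
    using assms unfolding spectrum_def eigenvalue_def eigenvector_def
    by (auto simp: mat_diag_def intro!: exI[of _ "unit_vec r i"])
qed

text \<open>Because one coefficient is diagonal, the Sylvester equation decouples into rows: the
  conjugate of a nonzero row $i$ of $Y$ would be an eigenvector of $- \Lambda^*$ for the
  eigenvalue $d_i$.\<close>

lemma sylvester_diag_unique:
  fixes Y \<Lambda> :: "complex mat"
  assumes Y: "Y \<in> carrier_mat r s" and \<Lambda>: "\<Lambda> \<in> carrier_mat s s"
    and eq: "Y * \<Lambda> = - (mat_adjoint (mat_diag r d) * Y)"
    and disj: "spectrum (mat_diag r d) \<inter> spectrum (- mat_adjoint \<Lambda>) = {}"
  shows "Y = 0\<^sub>m r s"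
proof (rule ccontr)
  assume "Y \<noteq> 0\<^sub>m r s"
  then obtain i j where ij: "i < r" "j < s" "Y $$ (i, j) \<noteq> 0"
    using Y by (metis carrier_matD eq_matI index_zero_mat)
  define v where "v = col (mat_adjoint Y) i"
  have D: "dim_row (mat_diag r d) = r" "dim_col (mat_diag r d) = r"
    by (simp_all add: mat_diag_def)
  have "mat_adjoint (Y * \<Lambda>) = - (mat_adjoint Y * mat_diag r d)"
    unfolding eq using Y D by (simp add: mat_adjoint_mult mat_adjoint_uminus)
  then have "- mat_adjoint \<Lambda> * mat_adjoint Y = mat_adjoint Y * mat_diag r d"
    using Y \<Lambda> D by (simp add: mat_adjoint_mult)
  then have "col (- mat_adjoint \<Lambda> * mat_adjoint Y) i = col (mat_adjoint Y * mat_diag r d) i"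
    by simp
  moreover have "col (- mat_adjoint \<Lambda> * mat_adjoint Y) i = - mat_adjoint \<Lambda> *\<^sub>v v"
    using Y \<Lambda> ij unfolding v_def by (intro col_mult2[of _ s s _ r]) auto
  moreover have "col (mat_adjoint Y * mat_diag r d) i = d i \<cdot>\<^sub>v v"
    using Y ij unfolding v_def
    by (subst mat_diag_mult_right[of _ s]) (auto intro!: eq_vecI)
  ultimately have "- mat_adjoint \<Lambda> *\<^sub>v v = d i \<cdot>\<^sub>v v"
    by simp
  moreover have "v $ j \<noteq> 0"
    using ij Y by (simp add: v_def)
  then have "v \<noteq> 0\<^sub>v s"
    using ij by auto
  moreover have "v \<in> carrier_vec s"
    unfolding v_def carrier_vec_def using Y by simp
  ultimately have "d i \<in> spectrum (- mat_adjoint \<Lambda>)"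
    unfolding spectrum_def eigenvalue_def eigenvector_def using \<Lambda> by auto
  with eigenvalue_mat_diag[OF ij(1)] disj show False
    by blast
qed

section \<open>Repeated diagonal entries\<close>

lemma pencil_mult_const:
  assumes "M \<in> carrier_mat N N" "K \<in> carrier_mat N N" "A \<in> carrier_mat N r"
  shows "pencil M K * map_mat (\<lambda>x. [:x:]) A = pencil (M * A) (K * A)"
proof -
  interpret lift: comm_ring_hom "\<lambda>x::complex. [:x:]"
    by unfold_locales (auto simp: one_pCons)
  show ?thesis
    unfolding pencil_def using assms
    by (simp add: add_mult_distrib_mat[of _ N N] lift.mat_hom_mult[of _ N N _ r]
      mult_smult_assoc_mat[of _ N N _ r])
qed

text \<open>After multiplication by the nonsingular constant matrix $A$, the columns $a$ and $b$ of
  the pencil are constant multiples of $\lambda - z$; pulling this factor out of both columns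
  shows that $(\lambda - z)^2$ divides the determinant.\<close>

lemma order_pencil_ge_2:
  fixes M K A :: "complex mat"
  assumes M: "M \<in> carrier_mat N N" and K: "K \<in> carrier_mat N N"
    and A: "A \<in> carrier_mat N N" and inv: "invertible_mat A"
    and reg: "regular_pencil M K"
    and ab: "a < N" "b < N" "a \<noteq> b"
    and eq: "\<And>i c. i < N \<Longrightarrow> c \<in> {a, b} \<Longrightarrow> (K * A) $$ (i, c) = - z * (M * A) $$ (i, c)"
  shows "Polynomial.order z (det (pencil M K)) \<ge> 2"
proof -
  interpret lift: comm_ring_hom "\<lambda>x::complex. [:x:]"
    by unfold_locales (auto simp: one_pCons)
  let ?L = "map_mat (\<lambda>x::complex. [:x:])"
  obtain B where B: "A * B = 1\<^sub>m N" "B * A = 1\<^sub>m (dim_row B)"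
    using inv A unfolding invertible_mat_def inverts_mat_def by auto
  have Bc: "B \<in> carrier_mat N N"
    using A B by (metis carrier_matD carrier_matI index_mult_mat(2,3) index_one_mat(2,3))
  have Pc: "pencil M K \<in> carrier_mat N N"
    using M K by (auto simp: pencil_def)
  \<comment> \<open>\<open>d\<close> holds the factors pulled out of the columns, and what remains is \<open>Z\<close>.\<close>
  define d where "d = (\<lambda>j. if j = a \<or> j = b then [:- z, 1:] else 1)"
  define Z where "Z = mat N N (\<lambda>(i, j). if j = a \<or> j = b then [:(M * A) $$ (i, j):]
    else (pencil M K * ?L A) $$ (i, j))"
  have Zc: "Z \<in> carrier_mat N N"
    by (simp add: Z_def)
  have "pencil M K * ?L A = Z * mat_diag N d"
  proof (rule eq_matI)
    fix i j assume "i < dim_row (Z * mat_diag N d)" "j < dim_col (Z * mat_diag N d)"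
    then have ij: "i < N" "j < N"
      by (auto simp: Z_def mat_diag_def)
    show "(pencil M K * ?L A) $$ (i, j) = (Z * mat_diag N d) $$ (i, j)"
    proof (cases "j = a \<or> j = b")
      case True
      then have "(K * A) $$ (i, j) = - z * (M * A) $$ (i, j)"
        using eq ij by blast
      moreover have "(pencil M K * ?L A) $$ (i, j) = [:0, 1:] * [:(M * A) $$ (i, j):] + [:(K * A) $$ (i, j):]"
        unfolding pencil_mult_const[OF M K A] using M K A ij by (auto simp: pencil_def)
      ultimately show ?thesis
        unfolding mat_diag_mult_right[OF Zc] using True ij by (simp add: Z_def d_def del: index_mult_mat(1))
    next
      case False
      then show ?thesis
        unfolding mat_diag_mult_right[OF Zc] using ij by (simp add: Z_def d_def del: index_mult_mat(1))
    qed
  qed (use Pc A in \<open>auto simp: Z_def mat_diag_def\<close>)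
  then have "det (pencil M K) * det (?L A) = det Z * det (mat_diag N d)"
    using det_mult[OF Pc, of "?L A"] det_mult[OF Zc mat_diag_dim, of d] A by simp
  moreover have "?L A * ?L B = 1\<^sub>m N"
    unfolding lift.mat_hom_mult[OF A Bc, symmetric] B(1) by (rule lift.mat_hom_one)
  then have "det (?L A) * det (?L B) = 1"
    using det_mult[of "?L A" N "?L B"] A Bc by (simp del: lift.hom_det)
  ultimately have "det (pencil M K) * (det (?L A) * det (?L B)) = det Z * det (mat_diag N d) * det (?L B)"
    unfolding mult.assoc[symmetric] by (simp only:)
  with \<open>det (?L A) * det (?L B) = 1\<close>
  have "det (pencil M K) = det (mat_diag N d) * (det Z * det (?L B))"
    by (simp only: mult_1_left mult_1_right ac_simps)
  then have dvd1: "det (mat_diag N d) dvd det (pencil M K)"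
    by (metis dvd_triv_left)
  have "det (mat_diag N d) = (\<Prod>j<N. d j)"
    by (subst det_upper_triangular[OF _ mat_diag_dim])
      (auto simp: mat_diag_def diag_mat_def prod.list_conv_set_nth atLeast0LessThan intro!: prod.cong)
  also have "\<dots> = d a * (d b * (\<Prod>j\<in>{..<N} - {a} - {b}. d j))"
    using ab by (simp add: prod.remove[of "{..<N}" a] prod.remove[of "{..<N} - {a}" b])
  also have "\<dots> = [:- z, 1:] ^ 2 * (\<Prod>j\<in>{..<N} - {a} - {b}. d j)"
    by (simp add: d_def power2_eq_square mult.assoc del: mult_pCons_left mult_pCons_right)
  finally have "[:- z, 1:] ^ 2 dvd det (pencil M K)"
    using dvd1 by (metis dvd_trans dvd_triv_left)
  then show ?thesis
    using reg order_divides unfolding regular_pencil_def by blast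
qed

section \<open>Indices paired by conjugation\<close>

text \<open>The involution on the zero-based positions of \<^const>\<open>paired_list\<close> that swaps the
  positions of $\lambda_j$ and $- \overline{\lambda_j}$ and fixes those of the purely imaginary
  entries.\<close>

definition mate :: "nat \<Rightarrow> nat \<Rightarrow> nat" where
  "mate m i = (if 2 * m \<le> i then i else if even i then i + 1 else i - 1)"

lemma mate_less: "m \<le> p \<Longrightarrow> i < m + p \<Longrightarrow> mate m i < m + p"
  unfolding mate_def by (auto elim!: evenE)

lemma mate_mate [simp]: "mate m (mate m i) = i"
  unfolding mate_def by (auto elim!: evenE oddE)

lemma length_paired_list [simp]: "m \<le> p \<Longrightarrow> length (paired_list m p l) = m + p"
  by (simp add: paired_list_def length_concat o_def sum_list_triv del: upt_Suc)

lemma nth_concat_pairs: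
  "i < 2 * length xs \<Longrightarrow> concat (map (\<lambda>j. [f j, g j]) xs) ! i =
     (if even i then f (xs ! (i div 2)) else g (xs ! (i div 2)))"
proof (induction xs arbitrary: i)
  case (Cons x xs)
  consider "i = 0" | "i = 1" | k where "i = Suc (Suc k)"
    by (metis One_nat_def not0_implies_Suc)
  then show ?case
    using Cons by cases auto
qed simp

lemma paired_list_nth:
  assumes "m \<le> p" "i < m + p"
  shows "paired_list m p l ! i =
    (if 2 * m \<le> i then l (i - m + 1)
     else if even i then l (i div 2 + 1) else - cnj (l (i div 2 + 1)))"
proof -
  have len: "length (concat (map (\<lambda>j. [l j, - cnj (l j)]) [1..<m + 1])) = 2 * m"
    by (simp add: length_concat o_def sum_list_triv)
  have idx: "[1..<m + 1] ! (i div 2) = i div 2 + 1" if "i < 2 * m"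
    using that by (subst nth_upt) auto
  show ?thesis
    using assms idx unfolding paired_list_def nth_append len
    by (auto simp: nth_concat_pairs simp del: upt_Suc)
qed

text \<open>A purely imaginary number equals minus its conjugate, which is why the unpaired
  positions may be their own partners.\<close>

lemma paired_list_mate:
  assumes "m \<le> p" "i < m + p" and imag: "\<forall>k\<in>{m + 1..p}. Re (l k) = 0"
  shows "paired_list m p l ! mate m i = - cnj (paired_list m p l ! i)"
proof (cases "2 * m \<le> i")
  case True
  then have "i - m + 1 \<in> {m + 1..p}"
    using assms by auto
  then have "Re (l (i - m + 1)) = 0"
    using imag by blast
  then show ?thesis
    using assms True by (simp add: paired_list_nth mate_def complex_eq_iff)
next
  case False
  then show ?thesis
    using assms mate_less[of m p i] by (auto simp: paired_list_nth mate_def elim!: evenE oddE)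
qed

text \<open>Simplicity is known for the numbers $\lambda_k$ only and not for
  $- \overline{\lambda_k}$; an entry of the second kind is reached through its partner.\<close>

lemma paired_list_representative:
  assumes "m \<le> p" "i < m + p"
  obtains k where "k \<in> {1..p}" "paired_list m p l ! i = l k \<or> paired_list m p l ! mate m i = l k"
proof (cases "2 * m \<le> i")
  case True
  then show ?thesis
    using assms by (intro that[of "i - m + 1"]) (auto simp: paired_list_nth)
next
  case False
  then show ?thesis
    using assms mate_less[of m p i]
    by (intro that[of "i div 2 + 1"]) (auto simp: paired_list_nth mate_def elim!: evenE oddE)
qed

text \<open>Let $e$ be the diagonal. The adjoint of the product has the $(i,j)$ entry
  $- \overline{e_i} A_{ij}$ by skewness of $A$. On the support of $A$ the index $j$ is the partner
  of $i$, so $- \overline{e_i} = e_j$.\<close>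

lemma pair_supported_mult_Hermitian:
  fixes A :: "complex mat"
  assumes A: "A \<in> carrier_mat (m + p) (m + p)" and mp: "m \<le> p"
    and imag: "\<forall>k\<in>{m + 1..p}. Re (l k) = 0"
    and supp: "\<And>i j. i < m + p \<Longrightarrow> j < m + p \<Longrightarrow> A $$ (i, j) \<noteq> 0 \<Longrightarrow> j = mate m i"
    and skew: "mat_adjoint A = - A"
  shows "mat_adjoint (A * paired_diag m p l) = A * paired_diag m p l"
proof (rule eq_matI)
  fix i j
  assume "i < dim_row (A * paired_diag m p l)" "j < dim_col (A * paired_diag m p l)"
  then have ij: "i < m + p" "j < m + p"
    using A mp by (auto simp: paired_diag_def mat_diag_def)
  have AD: "A * paired_diag m p l = mat (m + p) (m + p) (\<lambda>(i, j). A $$ (i, j) * paired_list m p l ! j)"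
    using A mp unfolding paired_diag_def by (simp add: mat_diag_mult_right[of _ "m + p"])
  have sk: "cnj (A $$ (j, i)) = - A $$ (i, j)"
    using arg_cong[OF skew, of "\<lambda>X. X $$ (i, j)"] A ij by simp
  show "mat_adjoint (A * paired_diag m p l) $$ (i, j) = (A * paired_diag m p l) $$ (i, j)"
  proof (cases "A $$ (i, j) = 0")
    case True
    then show ?thesis
      using ij sk unfolding AD by simp
  next
    case False
    then have "paired_list m p l ! j = - cnj (paired_list m p l ! i)"
      using supp[OF ij] paired_list_mate[OF mp ij(1) imag] by simp
    then show ?thesis
      using ij sk unfolding AD by simp
  qed
qed (use A mp in \<open>auto simp: paired_diag_def mat_diag_def\<close>)

text \<open>The pattern is built up from the front: a leading block of size two occupies the
  positions 0 and 1, which are partners, and the shift by two carries the involution of the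
  remaining blocks to that of the whole matrix.\<close>

lemma diag_block_mat_pair_supported:
  assumes "\<And>B. B \<in> set Bs \<Longrightarrow> B \<in> carrier_mat 2 2 \<and> B $$ (0, 0) = 0 \<and> B $$ (1, 1) = 0"
    and "\<And>C. C \<in> set Cs \<Longrightarrow> C \<in> carrier_mat 1 1"
    and "i < 2 * length Bs + length Cs" "j < 2 * length Bs + length Cs"
    and "diag_block_mat (Bs @ Cs) $$ (i, j) \<noteq> 0"
  shows "j = mate (length Bs) i"
  using assms
proof (induction Bs arbitrary: i j)
  case Nil
  then show ?case
  proof (induction Cs arbitrary: i j)
    case (Cons C Cs)
    have C: "C \<in> carrier_mat 1 1"
      using Cons.prems by auto
    have "map dim_row Cs = replicate (length Cs) 1" "map dim_col Cs = replicate (length Cs) 1"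
      using Cons.prems(2) by (auto simp: map_replicate_const[symmetric] intro!: map_cong)
    then have dims: "dim_row (diag_block_mat Cs) = length Cs" "dim_col (diag_block_mat Cs) = length Cs"
      unfolding dim_diag_block_mat by (simp_all add: sum_list_replicate)
    show ?case
      using Cons.IH[of "i - 1" "j - 1"] Cons.prems C dims
      by (cases i; cases j) (auto simp: Let_def mate_def)
  qed simp
next
  case (Cons B Bs)
  let ?D = "diag_block_mat (Bs @ Cs)"
  have B: "B \<in> carrier_mat 2 2" "B $$ (0, 0) = 0" "B $$ (1, 1) = 0"
    using Cons.prems by auto
  have "map dim_row (Bs @ Cs) = replicate (length Bs) 2 @ replicate (length Cs) 1"
    "map dim_col (Bs @ Cs) = replicate (length Bs) 2 @ replicate (length Cs) 1"
    using Cons.prems(1,2) by (auto simp: map_replicate_const[symmetric] intro!: map_cong)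
  then have dims: "dim_row ?D = 2 * length Bs + length Cs" "dim_col ?D = 2 * length Bs + length Cs"
    unfolding dim_diag_block_mat by (simp_all add: sum_list_replicate)
  have nz: "four_block_mat B (0\<^sub>m 2 (dim_col ?D)) (0\<^sub>m (dim_row ?D) 2) ?D $$ (i, j) \<noteq> 0"
    using Cons.prems(5) B by (simp add: Let_def)
  consider "i < 2" "j < 2" | "i \<ge> 2" "j \<ge> 2" | "i < 2" "j \<ge> 2" | "i \<ge> 2" "j < 2"
    by linarith
  then show ?case
  proof cases
    case 1
    then show ?thesis
      using nz B by (auto simp: less_2_cases_iff mate_def)
  next
    case 2
    have "?D $$ (i - 2, j - 2) \<noteq> 0"
      using nz 2 B(1) dims Cons.prems(3,4) by simp
    then have "j - 2 = mate (length Bs) (i - 2)"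
      using 2 Cons.prems(1-4) by (intro Cons.IH) auto
    moreover obtain i' j' where "i = Suc (Suc i')" "j = Suc (Suc j')"
      using 2 by (metis add_2_eq_Suc le_Suc_ex)
    ultimately show ?thesis
      by (auto simp: mate_def elim!: oddE)
  qed (use nz B(1) dims Cons.prems(3,4) in simp_all)
qed

lemma diag_block_mat_skew_Hermitian:
  assumes "\<And>B. B \<in> set Bs \<Longrightarrow> mat_adjoint B = - (B :: complex mat)"
  shows "mat_adjoint (diag_block_mat Bs) = - diag_block_mat Bs"
  using assms
proof (induction Bs)
  case Nil
  then show ?case
    by (intro eq_matI) auto
next
  case (Cons B Bs)
  let ?D = "diag_block_mat Bs"
  have skew: "mat_adjoint B = - B" "mat_adjoint ?D = - ?D"
    using Cons by auto
  have sq: "dim_col B = dim_row B" "dim_col ?D = dim_row ?D"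
    using arg_cong[OF skew(1), of dim_row] arg_cong[OF skew(2), of dim_row] by auto
  have B: "cnj (B $$ (j, i)) = - B $$ (i, j)" if "i < dim_row B" "j < dim_row B" for i j
    using arg_cong[OF skew(1), of "\<lambda>X. X $$ (i, j)"] that sq by simp
  have D: "cnj (?D $$ (j, i)) = - ?D $$ (i, j)" if "i < dim_row ?D" "j < dim_row ?D" for i j
    using arg_cong[OF skew(2), of "\<lambda>X. X $$ (i, j)"] that sq by simp
  show ?case
    using sq by (intro eq_matI) (auto simp: Let_def B D)
qed

lemma paired_block_diag_skew_Hermitian:
  assumes "\<forall>k\<in>{m + 1..p}. Re (\<mu> k) = 0"
  shows "mat_adjoint (paired_block_diag m p \<alpha> \<mu>) = - paired_block_diag m p \<alpha> \<mu>"
proof -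
  have "mat_adjoint B = - B"
    if "B \<in> (\<lambda>j. mat_of_rows_list 2 [[0, \<alpha> j], [- cnj (\<alpha> j), 0]]) ` {1..m}" for B
    using that by (auto intro!: eq_matI simp: mat_of_rows_list_def numeral_2_eq_2 less_Suc_eq)
  moreover have "mat_adjoint C = - C"
    if "C \<in> (\<lambda>k. mat_of_rows_list 1 [[\<mu> k]]) ` {m + 1..p}" for C
    using that assms by (auto intro!: eq_matI simp: mat_of_rows_list_def complex_eq_iff)
  ultimately show ?thesis
    unfolding paired_block_diag_def
    by (intro diag_block_mat_skew_Hermitian)
      (auto simp del: upt_Suc simp: atLeastLessThanSuc_atLeastAtMost)
qed

lemma paired_block_diag_pair_supported:
  assumes "m \<le> p" "i < m + p" "j < m + p" "paired_block_diag m p \<alpha> \<mu> $$ (i, j) \<noteq> 0"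
  shows "j = mate m i"
proof -
  let ?Bs = "map (\<lambda>j. mat_of_rows_list 2 [[0, \<alpha> j], [- cnj (\<alpha> j), 0]]) [1..<m + 1]"
  let ?Cs = "map (\<lambda>k. mat_of_rows_list 1 [[\<mu> k]]) [m + 1..<p + 1]"
  have "j = mate (length ?Bs) i"
    using assms unfolding paired_block_diag_def
    by (intro diag_block_mat_pair_supported[where Cs = ?Cs])
      (auto simp: mat_of_rows_list_def simp del: upt_Suc)
  then show ?thesis
    by (simp del: upt_Suc)
qed

section \<open>Low-rank updates of a pencil\<close>

lemma update_mult:
  fixes A W B V X :: "complex mat"
  assumes "A \<in> carrier_mat N N" "W \<in> carrier_mat N r" "B \<in> carrier_mat r r"
    "V \<in> carrier_mat r N" "X \<in> carrier_mat N s"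
  shows "(A + W * B * V) * X = A * X + W * B * (V * X)"
  using assms by (simp add: add_mult_distrib_mat[of _ N N] mult_mat_assoc)

text \<open>With $V X = I$ the update contributes $W E \Lambda' + W (G \Lambda - (G + E) \Lambda')
  = M X \Lambda - M X \Lambda'$ to the deflating relation, which cancels $M X \Lambda'$ and
  supplies the missing $M X \Lambda$. The matrix $E$ drops out, so it can be arbitrary.\<close>

lemma deflating_pair_replace:
  fixes M K X V W G E \<Lambda> \<Lambda>' :: "complex mat"
  assumes pair: "deflating_pair N r M K X \<Lambda>"
    and W: "W \<in> carrier_mat N r" and V: "V \<in> carrier_mat r N"
    and G: "G \<in> carrier_mat r r" and E: "E \<in> carrier_mat r r" and \<Lambda>': "\<Lambda>' \<in> carrier_mat r r"
    and VX: "V * X = 1\<^sub>m r" and WG: "W * G = M * X"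
  shows "deflating_pair N r (M + W * E * V) (K + W * (G * \<Lambda> - (G + E) * \<Lambda>') * V) X \<Lambda>'"
proof -
  have MK: "M \<in> carrier_mat N N" "K \<in> carrier_mat N N" and X: "X \<in> carrier_mat N r"
    and \<Lambda>: "\<Lambda> \<in> carrier_mat r r" and eq: "M * X * \<Lambda> + K * X = 0\<^sub>m N r"
    using pair by (auto simp: deflating_pair_def)
  define P Q where "P = M * X * \<Lambda>'" and "Q = W * E * \<Lambda>'"
  have PQ: "P \<in> carrier_mat N r" "Q \<in> carrier_mat N r"
    using MK X W E \<Lambda>' by (auto simp: P_def Q_def)
  have "(M + W * E * V) * X = M * X + W * E * (V * X)"
    by (rule update_mult[OF MK(1) W E V X])
  also have "\<dots> = M * X + W * E"
    using W E by (simp add: VX)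
  finally have MX: "(M + W * E * V) * X * \<Lambda>' = P + Q"
    using MK X W E \<Lambda>' by (simp add: add_mult_distrib_mat[of _ N r] P_def Q_def)
  let ?F = "G * \<Lambda> - (G + E) * \<Lambda>'"
  have F: "?F \<in> carrier_mat r r"
    using G E \<Lambda> \<Lambda>' by auto
  have "(K + W * ?F * V) * X = K * X + W * ?F * (V * X)"
    by (rule update_mult[OF MK(2) W F V X])
  also have "\<dots> = K * X + W * ?F"
    unfolding VX by (simp only: right_mult_one_mat[OF mult_carrier_mat[OF W F]])
  finally have KX: "(K + W * ?F * V) * X = K * X + W * ?F" .
  have "W * ?F = W * G * \<Lambda> - (W * G * \<Lambda>' + W * E * \<Lambda>')"
    using W G E \<Lambda> \<Lambda>' by (simp add: mult_minus_distrib_mat[of _ N r _ r]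
      mult_add_distrib_mat[of _ N r _ r] add_mult_distrib_mat[of _ r r] mult_mat_assoc)
  then have WF: "W * ?F = M * X * \<Lambda> - (P + Q)"
    by (simp add: WG P_def Q_def)
  have "P + Q + (K * X + W * ?F) = M * X * \<Lambda> + K * X"
    unfolding WF using PQ MK X \<Lambda> by (intro eq_matI) auto
  then have "(M + W * E * V) * X * \<Lambda>' + (K + W * ?F * V) * X = 0\<^sub>m N r"
    unfolding MX KX eq by simp
  then show ?thesis
    using pair W V F E \<Lambda>' by (auto simp: deflating_pair_def)
qed

lemma deflating_pair_keep:
  fixes M K X V W E F \<Lambda> :: "complex mat"
  assumes pair: "deflating_pair N s M K X \<Lambda>"
    and W: "W \<in> carrier_mat N r" and V: "V \<in> carrier_mat r N"
    and E: "E \<in> carrier_mat r r" and F: "F \<in> carrier_mat r r"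
    and VX: "V * X = 0\<^sub>m r s"
  shows "deflating_pair N s (M + W * E * V) (K + W * F * V) X \<Lambda>"
proof -
  have "(A + W * B * V) * X = A * X"
    if A: "A \<in> carrier_mat N N" and B: "B \<in> carrier_mat r r" for A B
  proof -
    have X: "X \<in> carrier_mat N s"
      using pair by (simp add: deflating_pair_def)
    show ?thesis
      unfolding update_mult[OF A W B V X]
      using A B X W VX by simp
  qed
  then show ?thesis
    using pair W V E F by (auto simp: deflating_pair_def)
qed

section \<open>Spectral update of a skew-Hamiltonian/Hamiltonian pencil\<close>

text \<open>The columns of $X_1$ are columns of the nonsingular matrix $[X_1\ X_2]$, and a diagonal
  $\Lambda_1$ turns each into an eigenvector of the pencil; hence equal diagonal entries give a
  multiple eigenvalue. If the repeated value is $- \overline{\lambda_k}$, the partner positions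
  repeat the simple eigenvalue $\lambda_k$.\<close>

lemma paired_list_distinct:
  assumes mp: "m \<le> p"
    and pairs: "complementary_deflating_pairs N (m + p) q M K X1 (paired_diag m p l) X2 \<Lambda>2"
    and regular: "regular_pencil M K"
    and simple: "\<forall>i\<in>{1..p}. simple_pencil_eigenvalue M K (l i)"
    and imag: "\<forall>k\<in>{m + 1..p}. Re (l k) = 0"
    and ij: "i < m + p" "j < m + p" "paired_list m p l ! i = paired_list m p l ! j"
  shows "i = j"
proof -
  let ?e = "\<lambda>i. paired_list m p l ! i" and ?D = "paired_diag m p l"
  let ?A = "mat_of_cols N (cols X1 @ cols X2)"
  have MK: "M \<in> carrier_mat N N" "K \<in> carrier_mat N N" and X1: "X1 \<in> carrier_mat N (m + p)"
    and X2: "X2 \<in> carrier_mat N q" and le: "m + p \<le> N"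
    and eq: "M * X1 * ?D + K * X1 = 0\<^sub>m N (m + p)" and inv: "invertible_mat ?A"
    using pairs by (auto simp: complementary_deflating_pairs_def deflating_pair_def)
  have A: "?A \<in> carrier_mat N N"
    using inv by (auto simp: invertible_mat_def)
  have colA: "col ?A c = col X1 c" if "c < m + p" for c
    using that X1 by (subst col_mat_of_cols) (auto simp: nth_append)
  have eig: "(K * ?A) $$ (k, c) = - ?e c * (M * ?A) $$ (k, c)" if k: "k < N" and c: "c < m + p" for k c
  proof -
    have "(M * X1 * ?D) $$ (k, c) = (M * X1) $$ (k, c) * ?e c"
      using k c X1 MK mp unfolding paired_diag_def
      by (subst mat_diag_mult_right[of _ N]) auto
    moreover have "(M * X1 * ?D + K * X1) $$ (k, c) = 0"
      unfolding eq using k c by simp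
    ultimately have "(K * X1) $$ (k, c) = - ?e c * (M * X1) $$ (k, c)"
      using k c X1 MK by (simp add: eq_neg_iff_add_eq_0 add.commute mult.commute del: index_mult_mat(1))
    then show ?thesis
      using k c X1 MK A le by (simp add: colA)
  qed
  have no_repeat: "a = b" if "a < m + p" "b < m + p" "?e a = ?e b" "?e a = l k" "k \<in> {1..p}" for a b k
  proof (rule ccontr)
    assume "a \<noteq> b"
    moreover have "(K * ?A) $$ (i, c) = - ?e a * (M * ?A) $$ (i, c)" if "i < N" "c \<in> {a, b}" for i c
      using eig[OF that(1), of c] \<open>a < m + p\<close> \<open>b < m + p\<close> \<open>?e a = ?e b\<close> that(2) by auto
    ultimately have "Polynomial.order (?e a) (det (pencil M K)) \<ge> 2"
      using that le by (intro order_pencil_ge_2[OF MK A inv regular, of a b]) auto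
    moreover have "Polynomial.order (l k) (det (pencil M K)) = 1"
      using simple that(5) by (auto simp: simple_pencil_eigenvalue_def)
    ultimately show False
      using that(4) by simp
  qed
  obtain k where k: "k \<in> {1..p}" "?e i = l k \<or> ?e (mate m i) = l k"
    using paired_list_representative[OF mp ij(1)] by metis
  show ?thesis
  proof (cases "?e i = l k")
    case True
    then show ?thesis
      using no_repeat[OF ij _ k(1)] by simp
  next
    case False
    have "?e (mate m i) = ?e (mate m j)"
      using ij by (simp add: paired_list_mate[OF mp _ imag])
    then have "mate m i = mate m j"
      using False k mate_less[OF mp] ij by (intro no_repeat[of _ _ k]) auto
    then show ?thesis
      by (metis mate_mate)
  qed
qed

theorem corollary7p2:
  fixes n m p q :: nat
    and M K Xc Xf \<Lambda>f G U Mh \<Delta>M \<Delta>K :: "complex mat"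
    and lc la \<alpha> \<mu> :: "nat \<Rightarrow> complex"
  assumes SHH: "star_SHH n M K"
    and regular: "regular_pencil M K"
    and mp: "m \<le> p"
    and pairs: "complementary_deflating_pairs (2 * n) (m + p) q M K Xc (paired_diag m p lc) Xf \<Lambda>f"
    and lc_nonimag: "\<forall>j\<in>{1..m}. Re (lc j) \<noteq> 0"
    and lc_imag: "\<forall>k\<in>{m + 1..p}. Re (lc k) = 0"
    and la_nonimag: "\<forall>j\<in>{1..m}. Re (la j) \<noteq> 0"
    and la_imag: "\<forall>k\<in>{m + 1..p}. Re (la k) = 0"
    and disjoint: "spectrum (paired_diag m p lc) \<inter> spectrum (- mat_adjoint \<Lambda>f) = {}"
    and G: "G = mat_adjoint Xc * Jmat n * M * Xc"
    and G_nonsingular: "invertible_mat G"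
    and simple: "\<forall>i\<in>{1..p}. simple_pencil_eigenvalue M K (lc i)"
    and U: "U = Jmat n * M * Xc * the (mat_inverse G)"
    and Mh: "Mh \<in> carrier_mat (m + p) (m + p)"
    and \<Delta>M: "\<Delta>M = mat_adjoint (Jmat n) * U * Mh * mat_adjoint U"
    and \<Delta>K: "\<Delta>K = mat_adjoint (Jmat n) * U *
               (G * paired_diag m p lc - (G + Mh) * paired_diag m p la) * mat_adjoint U"
  shows "complementary_deflating_pairs (2 * n) (m + p) q (M + \<Delta>M) (K + \<Delta>K)
           Xc (paired_diag m p la) Xf \<Lambda>f \<and>
         (Mh = paired_block_diag m p \<alpha> \<mu> \<and>
            (\<forall>j\<in>{1..m}. Re (\<alpha> j) \<noteq> 0) \<and> (\<forall>k\<in>{m + 1..p}. Re (\<mu> k) = 0)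
          \<longrightarrow> star_SHH n (M + \<Delta>M) (K + \<Delta>K))"
proof -
  define N r J S H D D' where "N = 2 * n" and "r = m + p" and "J = Jmat n"
    and "S = J * M" and "H = J * K"
    and "D = paired_diag m p lc" and "D' = paired_diag m p la"
  note abbr = N_def r_def J_def S_def H_def D_def D'_def
  have pair_c: "deflating_pair N r M K Xc D" and pair_f: "deflating_pair N q M K Xf \<Lambda>f"
    and inv: "invertible_mat (mat_of_cols N (cols Xc @ cols Xf))"
    using pairs by (auto simp: complementary_deflating_pairs_def abbr)
  have J: "J \<in> carrier_mat N N" and JJ: "mat_adjoint J * J = 1\<^sub>m N" "J * mat_adjoint J = 1\<^sub>m N"
    by (simp_all add: abbr Jmat_unitary)
  have MK: "M \<in> carrier_mat N N" "K \<in> carrier_mat N N"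
    and Xc: "Xc \<in> carrier_mat N r" and Xf: "Xf \<in> carrier_mat N q" and \<Lambda>f: "\<Lambda>f \<in> carrier_mat q q"
    using pair_c pair_f by (auto simp: deflating_pair_def)
  have S: "S \<in> carrier_mat N N" "mat_adjoint S = - S"
    and H: "H \<in> carrier_mat N N" "mat_adjoint H = H"
    using SHH J MK by (auto simp: star_SHH_def abbr)
  have D: "D \<in> carrier_mat r r" and D': "D' \<in> carrier_mat r r"
    using mp by (auto simp: abbr paired_diag_def)
  have E: "Mh \<in> carrier_mat r r"
    using Mh by (simp add: r_def)
  have J_eq: "S * X * \<Lambda> + H * X = 0\<^sub>m N s" if "deflating_pair N s M K X \<Lambda>" for X \<Lambda> s
  proof -
    have X: "X \<in> carrier_mat N s" and \<Lambda>: "\<Lambda> \<in> carrier_mat s s"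
      and eq: "M * X * \<Lambda> + K * X = 0\<^sub>m N s"
      using that by (auto simp: deflating_pair_def)
    have "S * X * \<Lambda> + H * X = J * (M * X * \<Lambda> + K * X)"
      using J MK X \<Lambda> by (simp add: S_def H_def mult_add_distrib_mat[of _ N N _ s] mult_mat_assoc)
    then show ?thesis
      unfolding eq using J by simp
  qed
  have G_S: "G = mat_adjoint Xc * S * Xc"
    unfolding G using J MK Xc by (simp add: S_def J_def mult_mat_assoc N_def)
  have Gc: "G \<in> carrier_mat r r"
    unfolding G_S using S Xc by auto
  have G_skew: "mat_adjoint G = - G"
    unfolding G_S using S Xc by (simp add: mat_adjoint_mult mult_mat_assoc)
  obtain Gi where Gi: "mat_inverse G = Some Gi"
  proof (cases "mat_inverse G")
    case None
    obtain B where "G * B = 1\<^sub>m r" "B * G = 1\<^sub>m (dim_row B)"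
      using G_nonsingular Gc unfolding invertible_mat_def inverts_mat_def by auto
    moreover from this have "B \<in> carrier_mat r r"
      using Gc by (metis carrier_matD carrier_matI index_mult_mat(2,3) index_one_mat(2,3))
    ultimately have "G \<in> Units (ring_mat TYPE(complex) r ())"
      using Gc by (auto simp: Units_def ring_mat_def)
    with mat_inverse(1)[OF Gc None, of "()"] show ?thesis
      by blast
  qed (use that in auto)
  have Gi_inv: "G * Gi = 1\<^sub>m r" "Gi * G = 1\<^sub>m r" and Gic: "Gi \<in> carrier_mat r r"
    using mat_inverse(2)[OF Gc Gi] by auto
  have U_S: "U = S * Xc * Gi"
    by (simp add: U Gi S_def J_def)
  have Uc: "U \<in> carrier_mat N r"
    unfolding U_S using S Xc Gic by auto
  define W where "W = mat_adjoint J * U"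
  have Wc: "W \<in> carrier_mat N r" and Vc: "mat_adjoint U \<in> carrier_mat r N"
    using J Uc by (auto simp: W_def)

  \<comment> \<open>$U^*$ is a left inverse of $X_c$ and annihilates $X_f$.\<close>
  have "mat_adjoint Xc * U = 1\<^sub>m r"
    using S Xc Gic Gi_inv G_S by (simp add: U_S mult_mat_assoc)
  then have "mat_adjoint (mat_adjoint Xc * U) = 1\<^sub>m r"
    by simp
  then have VXc: "mat_adjoint U * Xc = 1\<^sub>m r"
    using Xc Uc by (simp add: mat_adjoint_mult)
  have "W * G = mat_adjoint J * J * (M * Xc * (Gi * G))"
    using J MK Xc Gic Gc by (simp add: W_def U_S S_def mult_mat_assoc)
  then have WG: "W * G = M * Xc"
    using MK Xc by (simp add: JJ Gi_inv)

  have cross: "mat_adjoint Xc * S * Xf = 0\<^sub>m r q"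
  proof (rule sylvester_diag_unique)
    show "mat_adjoint Xc * S * Xf * \<Lambda>f
      = - (mat_adjoint (mat_diag r (\<lambda>i. paired_list m p lc ! i)) * (mat_adjoint Xc * S * Xf))"
      using skew_form_intertwines[OF S H Xc D Xf \<Lambda>f J_eq[OF pair_c] J_eq[OF pair_f]] mp
      by (simp add: D_def paired_diag_def r_def)
    show "spectrum (mat_diag r (\<lambda>i. paired_list m p lc ! i)) \<inter> spectrum (- mat_adjoint \<Lambda>f) = {}"
      using disjoint mp by (simp add: paired_diag_def r_def)
  qed (use S Xc Xf \<Lambda>f in auto)
  have "mat_adjoint U * Xf = - (mat_adjoint Gi * (mat_adjoint Xc * S * Xf))"
    using S Xc Xf Gic by (simp add: U_S mat_adjoint_mult mult_mat_assoc)
  also have "\<dots> = 0\<^sub>m r q"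
    unfolding cross using Gic by (intro eq_matI) auto
  finally have VXf: "mat_adjoint U * Xf = 0\<^sub>m r q" .

  let ?F = "G * D - (G + Mh) * D'"
  have F: "?F \<in> carrier_mat r r"
    using Gc D D' E by auto
  have \<Delta>M_W: "\<Delta>M = W * Mh * mat_adjoint U" and \<Delta>K_W: "\<Delta>K = W * ?F * mat_adjoint U"
    by (simp_all add: \<Delta>M \<Delta>K W_def abbr)
  have "deflating_pair N r (M + \<Delta>M) (K + \<Delta>K) Xc D'"
    unfolding \<Delta>M_W \<Delta>K_W
    by (rule deflating_pair_replace[OF pair_c Wc Vc Gc E D' VXc WG])
  moreover have "deflating_pair N q (M + \<Delta>M) (K + \<Delta>K) Xf \<Lambda>f"
    unfolding \<Delta>M_W \<Delta>K_W
    by (rule deflating_pair_keep[OF pair_f Wc Vc E F VXf])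
  ultimately have complementary:
    "complementary_deflating_pairs N r q (M + \<Delta>M) (K + \<Delta>K) Xc D' Xf \<Lambda>f"
    using inv by (simp add: complementary_deflating_pairs_def)

  \<comment> \<open>For structured \<open>Mh\<close>, the pairing pattern is shared by \<open>G\<close> and \<open>Mh\<close>, hence by their sum.\<close>
  have "star_SHH n (M + \<Delta>M) (K + \<Delta>K)"
    if Mh_eq: "Mh = paired_block_diag m p \<alpha> \<mu>" and \<mu>: "\<forall>k\<in>{m + 1..p}. Re (\<mu> k) = 0"
  proof -
    have Mh_skew: "mat_adjoint Mh = - Mh"
      unfolding Mh_eq by (rule paired_block_diag_skew_Hermitian[OF \<mu>])
    have GD: "G * D = - (mat_adjoint D * G)"
      unfolding G_S
      by (rule skew_form_intertwines[OF S H Xc D Xc D J_eq[OF pair_c] J_eq[OF pair_c]])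
    have GD_herm: "mat_adjoint (G * D) = G * D"
    proof -
      have "mat_adjoint (G * D) = - (mat_adjoint D * G)"
        using Gc D by (simp add: mat_adjoint_mult G_skew)
      then show ?thesis
        by (simp only: GD)
    qed
    have G_supp: "j = mate m i" if ij: "i < r" "j < r" "G $$ (i, j) \<noteq> 0" for i j
    proof -
      have "(G * D) $$ (i, j) = G $$ (i, j) * paired_list m p lc ! j"
        using Gc ij(1,2) mp by (simp add: D_def paired_diag_def r_def mat_diag_mult_right[of _ "m + p"])
      moreover have "mat_adjoint D = mat_diag r (\<lambda>i. cnj (paired_list m p lc ! i))"
        using mp by (intro eq_matI) (auto simp: D_def paired_diag_def r_def mat_diag_def)
      then have "(mat_adjoint D * G) $$ (i, j) = cnj (paired_list m p lc ! i) * G $$ (i, j)"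
        using Gc ij(1,2) by (simp add: mat_diag_mult_left[of _ r r])
      ultimately have "G $$ (i, j) * paired_list m p lc ! j = G $$ (i, j) * - cnj (paired_list m p lc ! i)"
        using arg_cong[OF GD, of "\<lambda>A. A $$ (i, j)"] ij(1,2) Gc D
        by (simp add: mult.commute del: index_mult_mat(1))
      then have "paired_list m p lc ! j = - cnj (paired_list m p lc ! i)"
        using ij(3) mult_left_cancel by blast
      also have "\<dots> = paired_list m p lc ! mate m i"
        using paired_list_mate[OF mp _ lc_imag] ij(1) by (simp add: r_def)
      finally show ?thesis
        using ij(1,2) mate_less[OF mp]
        by (intro paired_list_distinct[OF mp pairs regular simple lc_imag]) (auto simp: r_def)
    qed
    have "mat_adjoint ((G + Mh) * D') = (G + Mh) * D'"
      unfolding D'_def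
    proof (rule pair_supported_mult_Hermitian[OF _ mp la_imag])
      show "G + Mh \<in> carrier_mat (m + p) (m + p)"
        using Mh by simp
      show "mat_adjoint (G + Mh) = - (G + Mh)"
        using Gc E by (subst mat_adjoint_add) (auto simp: G_skew Mh_skew intro!: eq_matI)
      fix i j assume ij: "i < m + p" "j < m + p" "(G + Mh) $$ (i, j) \<noteq> 0"
      then have "G $$ (i, j) \<noteq> 0 \<or> Mh $$ (i, j) \<noteq> 0"
        using Mh by auto
      then show "j = mate m i"
        using G_supp ij paired_block_diag_pair_supported[OF mp ij(1,2)] by (auto simp: r_def Mh_eq)
    qed
    then have F_herm: "mat_adjoint ?F = ?F"
      using Gc D D' E GD_herm by (subst mat_adjoint_minus) auto
    have J_update: "J * (A + W * B * mat_adjoint U) = J * A + U * B * mat_adjoint U"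
      if A: "A \<in> carrier_mat N N" and B: "B \<in> carrier_mat r r" for A B
    proof -
      have "J * (A + W * B * mat_adjoint U) = J * A + J * (W * B * mat_adjoint U)"
        using Wc B Vc by (intro mult_add_distrib_mat[OF J A]) auto
      also have "J * (W * B * mat_adjoint U) = J * mat_adjoint J * (U * B * mat_adjoint U)"
        using J Uc B by (simp add: W_def mult_mat_assoc)
      also have "\<dots> = U * B * mat_adjoint U"
        using Uc B by (simp add: JJ)
      finally show ?thesis .
    qed
    have "mat_adjoint (J * (M + \<Delta>M)) = - (J * (M + \<Delta>M))"
      unfolding \<Delta>M_W J_update[OF MK(1) E] S_def[symmetric] using S Uc E
      by (subst mat_adjoint_add) (auto simp: adjoint_congruence Mh_skew intro!: eq_matI)
    moreover have "mat_adjoint (U * ?F * mat_adjoint U) = U * ?F * mat_adjoint U"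
      using adjoint_congruence[of ?F U] unfolding F_herm
      by (simp only: carrier_matD[OF F] carrier_matD[OF Uc])
    then have "mat_adjoint (J * (K + \<Delta>K)) = J * (K + \<Delta>K)"
      unfolding \<Delta>K_W J_update[OF MK(2) F] H_def[symmetric] using H Uc
      by (subst mat_adjoint_add) simp_all
    moreover have "M + \<Delta>M \<in> carrier_mat N N" "K + \<Delta>K \<in> carrier_mat N N"
      unfolding \<Delta>M_W \<Delta>K_W
      using mult_carrier_mat[OF mult_carrier_mat[OF Wc E] Vc]
        mult_carrier_mat[OF mult_carrier_mat[OF Wc F] Vc] by (simp_all only: add_carrier_mat)
    ultimately show ?thesis
      by (simp add: star_SHH_def N_def J_def)
  qed
  with complementary show ?thesis
    by (auto simp: abbr)
qed

end
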